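(* Let $0<\lambda<1$, $R=R(1/\lambda)$ and $F=F(1/\lambda)$, where $R(\cdot)$ is rounding to the nearest integer and $F(\cdot)$ is the signed fractional part. For $\nu\in(0,1)$ the following assertions are true: (i) For $x\in[0,|F|)\cup(1-|F|,1)$ we have $Z_\lambda B_2(x,\nu)\neq 0$. (ii) For $x\in[|F|,1-|F|]$ the zeros are characterized as follows: (a) If $\nu\in\{s/R: s=1,\dots,R-1\}$, then $Z_\lambda B_2(x,\nu)=0$ for every $x\in[|F|,1-|F|]$. (b) If $\nu\notin\{s/R: s=1,\dots,R-1\}$, then $Z_\lambda B_2(x,\nu)=0$ if and only if $$x=\tfrac12\quad\text{and}\quad \cot(\pi\nu)+2F\cot(\pi R\nu)=0.$$
   Context: The hat spline is $B_2=B_1*B_1$ with $B_1=\chi_{[-1/2,1/2)}$, i.e. $B_2(x)=\max(0,1-|x|)$. For $\lambda>0$ the Zak transform of $f$ is $$Z_\lambda f(x,\nu)=\sqrt{\lambda}\sum_{k\in\mathbb{Z}} f(\lambda(x-k))\,e^{2\pi i k\nu},\qquad (x,\nu)\in\mathbb{R}^2;$$ for $f=B_2$ the sum is finite for every $(x,\nu)$ and is understood pointwise. For $t\in\mathbb{R}$, $R(t)=\lfloor t+\tfrac12\rfloor$ denotes rounding to the nearest integer and $F(t)=t-R(t)\in[-\tfrac12,\tfrac12)$ denotes the signed fractional part. *)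

theory Defs
  imports "HOL-Analysis.Analysis"
begin

definition B1 :: "real \<Rightarrow> real" where
  "B1 = indicator {-1/2..<1/2}"

definition convolution :: "(real \<Rightarrow> real) \<Rightarrow> (real \<Rightarrow> real) \<Rightarrow> real \<Rightarrow> real" where
  "convolution f g x = (\<integral>t. f t * g (x - t) \<partial>lborel)"

definition B2 :: "real \<Rightarrow> real" where
  "B2 = convolution B1 B1"

lemma B2_eq: "B2 x = max 0 (1 - \<bar>x\<bar>)"
proof -
  define a b where "a = max (-1/2) (x - 1/2)" and "b = min (1/2) (x + 1/2)"
  have "AE t in lborel. t \<noteq> -1/2 \<and> t \<noteq> 1/2 \<and> t \<noteq> x - 1/2 \<and> t \<noteq> x + 1/2"
    by (intro AE_conjI AE_lborel_singleton)
  then have "AE t in lborel. B1 t * B1 (x - t) = indicator {a..b} t"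
    by eventually_elim (auto simp: B1_def a_def b_def indicator_def)
  then have "B2 x = (\<integral>t. indicator {a..b} t \<partial>lborel)"
    unfolding B2_def convolution_def by (intro integral_cong_AE) (auto simp: B1_def)
  also have "\<dots> = measure lborel {a..b}"
    by simp
  also have "\<dots> = max 0 (1 - \<bar>x\<bar>)"
    by (cases "a \<le> b") (simp_all add: a_def b_def min_def max_def abs_if split: if_splits)
  finally show ?thesis .
qed

text \<open>
  The Zak transform, as an unordered sum over the integers. Note that \<^const>\<open>infsum\<close> is
  \<open>0\<close> when the sum does not converge; for the hat spline only finitely many terms are
  nonzero, see \<open>finite_support_zak_B2\<close>.
\<close>

definition zak :: "real \<Rightarrow> (real \<Rightarrow> complex) \<Rightarrow> real \<Rightarrow> real \<Rightarrow> complex" where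
  "zak lam f x \<nu> = complex_of_real (sqrt lam) *
     (\<Sum>\<^sub>\<infinity>k::int. f (lam * (x - of_int k)) * exp (2 * pi * \<i> * of_int k * \<nu>))"

lemma finite_support_zak_B2:
  assumes "lam > 0"
  shows "finite {k::int. B2 (lam * (x - of_int k)) \<noteq> 0}"
proof (rule finite_subset)
  show "{k::int. B2 (lam * (x - of_int k)) \<noteq> 0} \<subseteq> {\<lfloor>x - 1/lam\<rfloor>..\<lceil>x + 1/lam\<rceil>}"
  proof clarsimp
    fix k :: int
    assume "B2 (lam * (x - of_int k)) \<noteq> 0"
    then have "lam * \<bar>x - of_int k\<bar> < 1"
      using assms by (auto simp: B2_eq abs_mult max_def split: if_splits)
    then have "\<bar>x - of_int k\<bar> < 1/lam"
      using assms by (simp add: field_simps)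
    then show "\<lfloor>x - 1/lam\<rfloor> \<le> k \<and> k \<le> \<lceil>x + 1/lam\<rceil>"
      by linarith
  qed
qed simp

text \<open>
  Rounding to the nearest integer is the library's \<^const>\<open>round\<close>, which is defined by
  \<open>round t = \<lfloor>t + 1/2\<rfloor>\<close>.
\<close>

definition signed_frac :: "real \<Rightarrow> real" where
  "signed_frac t = t - of_int (round t)"

end

theory Submission
  imports Defs
begin

text \<open>
  Put \<open>a = 1/\<lambda>\<close> and \<open>\<theta> = \<pi>\<nu>\<close>, so that \<open>sin \<theta> > 0\<close>. Up to the positive factor \<open>\<lambda>\<^sup>3\<^sup>/\<^sup>2\<close> the Zak
  transform is \<open>S(x) = \<Sum>k. max 0 (a - \<bar>x - k\<bar>) e\<^sup>2\<^sup>i\<^sup>k\<^sup>\<theta>\<close>, which on \<open>[0,1]\<close> is piecewise linear with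
  breaks only at \<open>\<bar>F\<bar>\<close> and \<open>1 - \<bar>F\<bar>\<close>, because \<open>x \<plusminus> a\<close> is an integer only there. On each piece the set
  of contributing \<open>k\<close> is fixed, and the sum has a closed form.

  For \<open>\<bar>F\<bar> \<le> x \<le> 1 - \<bar>F\<bar>\<close> the contributing \<open>k\<close> are \<open>1 - R, \<dots>, R\<close>. Pairing \<open>k\<close> with \<open>1 - k\<close> gives
  \<open>S(x) = e\<^sup>i\<^sup>\<theta> (C + i (2x - 1) sin\<^sup>2(R\<theta>) / sin \<theta>)\<close> with \<open>C\<close> real and
  \<open>C = sin\<^sup>2(R\<theta>) / sin \<theta> \<cdot> (cot \<theta> + 2F cot (R\<theta>))\<close> whenever \<open>sin (R\<theta>) \<noteq> 0\<close>
  (\<open>zak_B2_central\<close>). Everything vanishes when \<open>sin (R\<theta>) = 0\<close>, that is, when \<open>R\<nu>\<close> is an integer;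
  otherwise the imaginary part forces \<open>x = 1/2\<close>, and the real part is the cotangent equation.

  For \<open>0 \<le> x < \<bar>F\<bar>\<close> the contributing \<open>k\<close> are \<open>-N, \<dots>, N\<close> with \<open>N = \<lfloor>a\<rfloor>\<close> the integer part, rather
  than the nearest integer. Pairing \<open>k\<close> with \<open>-k\<close> gives \<open>S(x) = S(0) - x + 2ixT\<close> with \<open>S(0)\<close> and
  \<open>T\<close> real (\<open>zak_B2_outer\<close>). Here \<open>S(0)\<close> is the convex combination of two consecutive Fejer
  kernels \<open>sin\<^sup>2(N\<theta>) / sin\<^sup>2 \<theta>\<close> and \<open>sin\<^sup>2((N+1)\<theta>) / sin\<^sup>2 \<theta>\<close> with weights \<open>1 - f\<close> and \<open>f = a - N\<close>, and
  \<open>T = sin (N\<theta>) sin ((N+1)\<theta>) / sin \<theta>\<close>. If \<open>T = 0\<close>, one of the two kernels vanishes and the other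
  is \<open>1\<close>, so \<open>S(0) \<ge> min f (1 - f) = \<bar>F\<bar> > x\<close>; and \<open>S(0) > 0\<close> in any case. Hence \<open>S(x) \<noteq> 0\<close>
  (\<open>zak_B2_outer_nonzero\<close>). The remaining interval follows from the symmetry
  \<open>S(1 - x) = e\<^sup>2\<^sup>i\<^sup>\<theta> cnj (S(x))\<close> (\<open>zak_B2_reflect\<close>).
\<close>

section \<open>Dirichlet and Fejer type sums\<close>

lemma sin_times_sum_sin_odd:
  fixes \<theta> :: real
  shows "sin \<theta> * (\<Sum>j<n. sin ((2 * real j + 1) * \<theta>)) = (sin (real n * \<theta>))\<^sup>2"
proof (induction n)
  case (Suc n)
  define p q c u where d: "p = cos (real n * \<theta>)" "q = sin (real n * \<theta>)" "c = cos \<theta>" "u = sin \<theta>"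
  have P: "p\<^sup>2 + q\<^sup>2 = 1" "c\<^sup>2 + u\<^sup>2 = 1"
    by (simp_all add: d)
  have 1: "sin ((2 * real n + 1) * \<theta>) = 2 * p * q * c + (p\<^sup>2 - q\<^sup>2) * u"
    using sin_add[of "2 * (real n * \<theta>)" \<theta>]
    unfolding sin_double cos_double d[symmetric] by (simp add: algebra_simps)
  have 2: "sin (real (Suc n) * \<theta>) = q * c + p * u"
    using sin_add[of "real n * \<theta>" \<theta>] by (simp add: d algebra_simps)
  have "q\<^sup>2 + u * (2 * p * q * c + (p\<^sup>2 - q\<^sup>2) * u) = (q * c + p * u)\<^sup>2"
    using P by algebra
  then show ?case
    using Suc unfolding sum.lessThan_Suc distrib_left[of "sin \<theta>"] 1 2 by (simp add: d distrib_left)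
qed simp

lemma sin_squared_times_weighted_sum_cos_odd:
  fixes \<theta> :: real
  shows "(sin \<theta>)\<^sup>2 * (\<Sum>j<n. 2 * (a - real j - 1/2) * cos ((2 * real j + 1) * \<theta>)) =
    cos \<theta> * (sin (real n * \<theta>))\<^sup>2 +
    2 * (a - real n) * (sin \<theta> * sin (real n * \<theta>) * cos (real n * \<theta>))"
proof (induction n)
  case (Suc n)
  define p q c u m where d: "p = cos (real n * \<theta>)" "q = sin (real n * \<theta>)"
    "c = cos \<theta>" "u = sin \<theta>" "m = a - real n"
  have P: "p\<^sup>2 + q\<^sup>2 = 1" "c\<^sup>2 + u\<^sup>2 = 1"
    by (simp_all add: d)
  have 1: "cos ((2 * real n + 1) * \<theta>) = (p\<^sup>2 - q\<^sup>2) * c - 2 * p * q * u"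
    using cos_add[of "2 * (real n * \<theta>)" \<theta>]
    unfolding sin_double cos_double d[symmetric] by (simp add: algebra_simps)
  have 2: "sin (real (Suc n) * \<theta>) = q * c + p * u" "cos (real (Suc n) * \<theta>) = p * c - q * u"
    "a - real (Suc n) = m - 1" "a - real n - 1/2 = m - 1/2"
    using sin_add[of "real n * \<theta>" \<theta>] cos_add[of "real n * \<theta>" \<theta>]
    by (simp_all add: d algebra_simps)
  have "(c * q\<^sup>2 + 2 * m * (u * q * p)) + u\<^sup>2 * (2 * (m - 1/2) * ((p\<^sup>2 - q\<^sup>2) * c - 2 * p * q * u)) =
    c * (q * c + p * u)\<^sup>2 + 2 * (m - 1) * (u * (q * c + p * u) * (p * c - q * u))"
    using P by algebra
  then show ?case
    using Suc unfolding sum.lessThan_Suc distrib_left[of "(sin \<theta>)\<^sup>2"] 1 2 by (simp add: d)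
qed simp

lemma sin_times_sum_sin_even:
  fixes \<theta> :: real
  shows "sin \<theta> * (\<Sum>j<n. sin (2 * (real j + 1) * \<theta>)) =
    sin (real n * \<theta>) * sin ((real n + 1) * \<theta>)"
proof (induction n)
  case (Suc n)
  define p q c u where d: "p = cos ((real n + 1) * \<theta>)" "q = sin ((real n + 1) * \<theta>)"
    "c = cos \<theta>" "u = sin \<theta>"
  have 1: "sin (2 * (real n + 1) * \<theta>) = 2 * q * p"
    using sin_double[of "(real n + 1) * \<theta>"] by (simp add: mult_ac d)
  have 2: "sin (real n * \<theta>) = q * c - p * u" "sin ((real (Suc n) + 1) * \<theta>) = q * c + p * u"
    "sin (real (Suc n) * \<theta>) = q"
    using sin_diff[of "(real n + 1) * \<theta>" \<theta>] sin_add[of "(real n + 1) * \<theta>" \<theta>]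
    by (simp_all add: d algebra_simps)
  have "(q * c - p * u) * q + u * (2 * q * p) = q * (q * c + p * u)"
    by algebra
  then show ?case
    using Suc unfolding sum.lessThan_Suc distrib_left[of "sin \<theta>"] 1 2 by (simp add: d)
qed simp

text \<open>
  The triangle weights \<open>a - \<bar>k\<bar>\<close> with \<open>\<bar>k\<bar> \<le> n\<close> interpolate linearly in \<open>a\<close> between those of two
  consecutive Fejer kernels, so for \<open>n \<le> a \<le> n + 1\<close> the sum is a convex combination of these.
\<close>

lemma sin_squared_times_interpolated_fejer:
  fixes \<theta> :: real
  shows "(sin \<theta>)\<^sup>2 * (a + (\<Sum>j<n. 2 * (a - real j - 1) * cos (2 * (real j + 1) * \<theta>))) =
    (1 - (a - real n)) * (sin (real n * \<theta>))\<^sup>2 + (a - real n) * (sin ((real n + 1) * \<theta>))\<^sup>2"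
proof (induction n)
  case (Suc n)
  define p q c u m where d: "p = cos (real n * \<theta>)" "q = sin (real n * \<theta>)"
    "c = cos \<theta>" "u = sin \<theta>" "m = a - real n"
  define q1 p1 where q1: "q1 = q * c + p * u" "p1 = p * c - q * u"
  have P: "p\<^sup>2 + q\<^sup>2 = 1" "c\<^sup>2 + u\<^sup>2 = 1"
    by (simp_all add: d)
  have 2: "sin ((real n + 1) * \<theta>) = q1" "cos ((real n + 1) * \<theta>) = p1"
    "sin (real (Suc n) * \<theta>) = q1" "a - real (Suc n) = m - 1" "a - real n - 1 = m - 1"
    using sin_add[of "real n * \<theta>" \<theta>] cos_add[of "real n * \<theta>" \<theta>]
    by (simp_all add: d q1 algebra_simps)
  have 1: "cos (2 * (real n + 1) * \<theta>) = p1\<^sup>2 - q1\<^sup>2"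
    using cos_double[of "(real n + 1) * \<theta>"] 2 by (simp add: mult_ac)
  have 3: "sin ((real (Suc n) + 1) * \<theta>) = q1 * c + p1 * u"
    using sin_add[of "(real n + 1) * \<theta>" \<theta>] 2 by (simp add: d algebra_simps)
  have "((1 - m) * q\<^sup>2 + m * q1\<^sup>2) + u\<^sup>2 * (2 * (m - 1) * (p1\<^sup>2 - q1\<^sup>2)) =
    (1 - (m - 1)) * q1\<^sup>2 + (m - 1) * (q1 * c + p1 * u)\<^sup>2"
    using P q1 by algebra
  then show ?case
    using Suc unfolding sum.lessThan_Suc add.assoc[symmetric]
      distrib_left[of "(sin \<theta>)\<^sup>2"] 1 2 3 by (simp add: d)
qed (simp add: algebra_simps)

section \<open>Exponential sums with triangle weights\<close>

lemma sum_int_interval_pair_about_half: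
  fixes g :: "int \<Rightarrow> 'a::comm_monoid_add"
  shows "sum g {1 - int n..int n} = (\<Sum>j<n. g (int j + 1) + g (- int j))"
proof (induction n)
  case (Suc n)
  have "{1 - int (Suc n)..int (Suc n)} = insert (int n + 1) (insert (- int n) {1 - int n..int n})"
    by auto
  then show ?case
    using Suc by (simp add: add_ac)
qed simp

lemma sum_int_interval_pair_about_zero:
  fixes g :: "int \<Rightarrow> 'a::comm_monoid_add"
  shows "sum g {- int n..int n} = g 0 + (\<Sum>j<n. g (int j + 1) + g (- (int j + 1)))"
proof (induction n)
  case (Suc n)
  have "{- int (Suc n)..int (Suc n)} =
      insert (int n + 1) (insert (- (int n + 1)) {- int n..int n})"
    by auto
  then show ?case
    using Suc by (simp add: add_ac)
qed simp

text \<open>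
  The points \<open>j + 1\<close> and \<open>-j\<close> are symmetric about \<open>1/2\<close>. Their weights have the mean
  \<open>a - j - 1/2\<close> and differ by \<open>2x - 1\<close>, and their exponentials are \<open>cis \<theta>\<close> times conjugate numbers.
\<close>

lemma triangle_exp_sum_about_half:
  assumes "0 \<le> x" "x \<le> 1"
  shows "(\<Sum>k\<in>{1 - int n..int n}. of_real (a - \<bar>x - of_int k\<bar>) * cis (2 * of_int k * \<theta>)) =
    cis \<theta> * Complex (\<Sum>j<n. 2 * (a - real j - 1/2) * cos ((2 * real j + 1) * \<theta>))
                    ((2 * x - 1) * (\<Sum>j<n. sin ((2 * real j + 1) * \<theta>)))"
proof -
  let ?g = "\<lambda>k::int. of_real (a - \<bar>x - of_int k\<bar>) * cis (2 * of_int k * \<theta>)"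
  have "?g (int j + 1) + ?g (- int j) =
      cis \<theta> * Complex (2 * (a - real j - 1/2) * cos ((2 * real j + 1) * \<theta>))
                      ((2 * x - 1) * sin ((2 * real j + 1) * \<theta>))" (is "?l = ?r") for j :: nat
  proof -
    define \<phi> where "\<phi> = (2 * real j + 1) * \<theta>"
    have c: "cis (2 * of_int (int j + 1) * \<theta>) = cis \<theta> * cis \<phi>"
      "cis (2 * of_int (- int j) * \<theta>) = cis \<theta> * cis (- \<phi>)"
      unfolding cis_mult \<phi>_def by (auto intro!: arg_cong[where f = cis] simp: algebra_simps)
    have w: "\<bar>x - of_int (int j + 1)\<bar> = real j + 1 - x" "\<bar>x - of_int (- int j)\<bar> = x + real j"
      using assms by auto
    have "?l = cis \<theta> * (of_real (a - (real j + 1 - x)) * cis \<phi> + of_real (a - (x + real j)) * cis (- \<phi>))"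
      unfolding c w by (simp add: algebra_simps)
    also have "of_real (a - (real j + 1 - x)) * cis \<phi> + of_real (a - (x + real j)) * cis (- \<phi>) =
        Complex (2 * (a - real j - 1/2) * cos \<phi>) ((2 * x - 1) * sin \<phi>)"
      by (simp add: complex_eq_iff algebra_simps)
    finally show ?thesis
      by (simp add: \<phi>_def)
  qed
  moreover have "(\<Sum>j<n. Complex (2 * (a - real j - 1/2) * cos ((2 * real j + 1) * \<theta>))
                            ((2 * x - 1) * sin ((2 * real j + 1) * \<theta>))) =
      Complex (\<Sum>j<n. 2 * (a - real j - 1/2) * cos ((2 * real j + 1) * \<theta>))
              ((2 * x - 1) * (\<Sum>j<n. sin ((2 * real j + 1) * \<theta>)))"
    by (simp only: complex_eq_iff Re_sum Im_sum complex.sel sum_distrib_left)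
  ultimately show ?thesis
    unfolding sum_int_interval_pair_about_half by (simp only: sum_distrib_left[symmetric])
qed

lemma triangle_exp_sum_about_zero:
  assumes "0 \<le> x" "x \<le> 1"
  shows "(\<Sum>k\<in>{- int n..int n}. of_real (a - \<bar>x - of_int k\<bar>) * cis (2 * of_int k * \<theta>)) =
    Complex (a + (\<Sum>j<n. 2 * (a - real j - 1) * cos (2 * (real j + 1) * \<theta>)) - x)
            (2 * x * (\<Sum>j<n. sin (2 * (real j + 1) * \<theta>)))"
proof -
  let ?g = "\<lambda>k::int. of_real (a - \<bar>x - of_int k\<bar>) * cis (2 * of_int k * \<theta>)"
  have "?g (int j + 1) + ?g (- (int j + 1)) =
      Complex (2 * (a - real j - 1) * cos (2 * (real j + 1) * \<theta>))
              (2 * x * sin (2 * (real j + 1) * \<theta>))" (is "?l = ?r") for j :: nat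
  proof -
    define \<phi> where "\<phi> = 2 * (real j + 1) * \<theta>"
    have c: "cis (2 * of_int (int j + 1) * \<theta>) = cis \<phi>"
      "cis (2 * of_int (- (int j + 1)) * \<theta>) = cis (- \<phi>)"
      unfolding \<phi>_def by (auto intro!: arg_cong[where f = cis] simp: algebra_simps)
    have w: "\<bar>x - of_int (int j + 1)\<bar> = real j + 1 - x"
      "\<bar>x - of_int (- (int j + 1))\<bar> = x + real j + 1"
      using assms by auto
    show ?thesis
      unfolding c w \<phi>_def[symmetric] by (simp add: complex_eq_iff algebra_simps)
  qed
  moreover have "?g 0 = Complex (a - x) 0"
    using assms by (simp add: complex_eq_iff)
  ultimately show ?thesis
    unfolding sum_int_interval_pair_about_zero
    by (simp add: sum_distrib_left[symmetric] complex_eq_iff)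
qed

section \<open>The Zak transform of the hat spline\<close>

text \<open>
  At \<open>\<bar>x - k\<bar> = 1/\<lambda>\<close> the summand is \<open>0\<close> either way, so both inequalities can be weak. This makes the
  formulas below valid on closed intervals.
\<close>

lemma zak_B2_eq_sum:
  assumes lam: "lam > 0" and "finite K"
    and inside: "\<And>k. k \<in> K \<Longrightarrow> \<bar>x - of_int k\<bar> \<le> 1 / lam"
    and outside: "\<And>k. k \<notin> K \<Longrightarrow> \<bar>x - of_int k\<bar> \<ge> 1 / lam"
  shows "zak lam (\<lambda>t. complex_of_real (B2 t)) x \<nu> = of_real (lam * sqrt lam) *
    (\<Sum>k\<in>K. of_real (1 / lam - \<bar>x - of_int k\<bar>) * cis (2 * of_int k * (pi * \<nu>)))"
proof -
  have abs_eq: "\<bar>lam * (x - of_int k)\<bar> = lam * \<bar>x - of_int k\<bar>" for k :: int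
    using lam by (simp add: abs_mult)
  have out: "B2 (lam * (x - of_int k)) = 0" if "k \<notin> K" for k
    unfolding B2_eq abs_eq using outside[OF that] lam by (simp add: field_simps)
  have ins: "B2 (lam * (x - of_int k)) = lam * (1 / lam - \<bar>x - of_int k\<bar>)" if "k \<in> K" for k
    unfolding B2_eq abs_eq using inside[OF that] lam by (simp add: field_simps)
  have "zak lam (\<lambda>t. complex_of_real (B2 t)) x \<nu> = of_real (sqrt lam) *
      (\<Sum>\<^sub>\<infinity>k\<in>K. of_real (B2 (lam * (x - of_int k))) * exp (2 * pi * \<i> * of_int k * \<nu>))"
    unfolding zak_def
    by (intro arg_cong2[where f = "(*)"] refl infsum_cong_neutral) (auto simp: out)
  also have "\<dots> = of_real (sqrt lam) *
      (\<Sum>k\<in>K. of_real (B2 (lam * (x - of_int k))) * exp (2 * pi * \<i> * of_int k * \<nu>))"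
    using \<open>finite K\<close> by simp
  also have "(\<Sum>k\<in>K. of_real (B2 (lam * (x - of_int k))) * exp (2 * pi * \<i> * of_int k * \<nu>)) =
      of_real lam * (\<Sum>k\<in>K. of_real (1 / lam - \<bar>x - of_int k\<bar>) * cis (2 * of_int k * (pi * \<nu>)))"
    unfolding sum_distrib_left
  proof (rule sum.cong[OF refl])
    fix k assume k: "k \<in> K"
    have "exp (2 * pi * \<i> * of_int k * \<nu>) = cis (2 * of_int k * (pi * \<nu>))"
      unfolding cis_conv_exp by (simp add: mult_ac)
    then show "of_real (B2 (lam * (x - of_int k))) * exp (2 * pi * \<i> * of_int k * \<nu>) =
      of_real lam * (of_real (1 / lam - \<bar>x - of_int k\<bar>) * cis (2 * of_int k * (pi * \<nu>)))"
      unfolding ins[OF k] of_real_mult by (simp add: mult_ac)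
  qed
  finally show ?thesis
    by (simp add: mult_ac)
qed

text \<open>
  The hat spline is real and even, so the substitution \<open>k \<mapsto> 1 - k\<close> turns the sum at \<open>1 - x\<close> into the
  conjugate of the sum at \<open>x\<close>, up to a phase.
\<close>

lemma zak_B2_reflect:
  "zak lam (\<lambda>t. complex_of_real (B2 t)) (1 - x) \<nu> =
   cis (2 * pi * \<nu>) * cnj (zak lam (\<lambda>t. complex_of_real (B2 t)) x \<nu>)"
proof -
  let ?g = "\<lambda>x k::int. complex_of_real (B2 (lam * (x - of_int k))) * exp (2 * pi * \<i> * of_int k * \<nu>)"
  have e: "exp (2 * pi * \<i> * of_int k * \<nu>) = cis (2 * pi * of_int k * \<nu>)" for k :: int
    unfolding cis_conv_exp by (simp add: mult_ac)
  have "infsum (?g (1 - x)) UNIV = (\<Sum>\<^sub>\<infinity>k. ?g (1 - x) (1 - k))"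
    by (rule infsum_reindex_bij_witness[of _ "\<lambda>k. 1 - k" "\<lambda>k. 1 - k"]) auto
  also have "\<dots> = (\<Sum>\<^sub>\<infinity>k. cis (2 * pi * \<nu>) * cnj (?g x k))"
  proof (rule infsum_cong)
    fix k :: int
    have "B2 (lam * (1 - x - of_int (1 - k))) = B2 (lam * (x - of_int k))"
      by (simp add: B2_eq abs_mult abs_minus_commute)
    then show "?g (1 - x) (1 - k) = cis (2 * pi * \<nu>) * cnj (?g x k)"
      unfolding e by (simp add: cis_cnj cis_mult algebra_simps)
  qed
  also have "\<dots> = cis (2 * pi * \<nu>) * cnj (infsum (?g x) UNIV)"
    unfolding infsum_cmult_right' infsum_cnj ..
  finally show ?thesis
    unfolding zak_def by (simp only: complex_cnj_mult complex_cnj_complex_of_real mult_ac)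
qed

lemma zak_B2_reflect_eq_0_iff:
  "zak lam (\<lambda>t. complex_of_real (B2 t)) (1 - x) \<nu> = 0 \<longleftrightarrow>
   zak lam (\<lambda>t. complex_of_real (B2 t)) x \<nu> = 0"
  unfolding zak_B2_reflect mult_eq_0_iff complex_cnj_zero_iff by (simp add: cis_neq_zero)

text \<open>
  For \<open>\<bar>F\<bar> \<le> x \<le> 1 - \<bar>F\<bar>\<close> the interval \<open>[x - 1/\<lambda>, x + 1/\<lambda>]\<close> runs from \<open>x - F - n \<in> [-n, 1 - n]\<close> to
  \<open>x + F + n \<in> [n, n + 1]\<close>, so the integers in it, up to ends where the hat vanishes, are
  \<open>1 - n, \<dots>, n\<close>, and these are centred at \<open>1/2\<close>.
\<close>

lemma zak_B2_central:
  fixes lam x \<nu> :: real and n :: nat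
  defines "\<theta> \<equiv> pi * \<nu>" and "F \<equiv> 1 / lam - real n"
  assumes lam: "lam > 0" and x: "\<bar>F\<bar> \<le> x" "x \<le> 1 - \<bar>F\<bar>" and s: "sin \<theta> \<noteq> 0"
  shows "zak lam (\<lambda>t. complex_of_real (B2 t)) x \<nu> = of_real (lam * sqrt lam) * (cis \<theta> *
    Complex ((cos \<theta> * (sin (real n * \<theta>))\<^sup>2 +
              2 * F * (sin \<theta> * sin (real n * \<theta>) * cos (real n * \<theta>))) / (sin \<theta>)\<^sup>2)
            ((2 * x - 1) * ((sin (real n * \<theta>))\<^sup>2 / sin \<theta>)))"
proof -
  have x01: "0 \<le> x" "x \<le> 1"
    using x by linarith+
  have C: "(\<Sum>j<n. 2 * (1 / lam - real j - 1/2) * cos ((2 * real j + 1) * \<theta>)) =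
      (cos \<theta> * (sin (real n * \<theta>))\<^sup>2 +
       2 * F * (sin \<theta> * sin (real n * \<theta>) * cos (real n * \<theta>))) / (sin \<theta>)\<^sup>2"
    unfolding F_def sin_squared_times_weighted_sum_cos_odd[symmetric] using s by simp
  have D: "(\<Sum>j<n. sin ((2 * real j + 1) * \<theta>)) = (sin (real n * \<theta>))\<^sup>2 / sin \<theta>"
    unfolding sin_times_sum_sin_odd[symmetric] using s by simp
  have "zak lam (\<lambda>t. complex_of_real (B2 t)) x \<nu> = of_real (lam * sqrt lam) *
      (\<Sum>k\<in>{1 - int n..int n}. of_real (1 / lam - \<bar>x - of_int k\<bar>) * cis (2 * of_int k * \<theta>))"
    unfolding \<theta>_def
  proof (rule zak_B2_eq_sum[OF lam])
    fix k
    show "\<bar>x - of_int k\<bar> \<le> 1 / lam" if "k \<in> {1 - int n..int n}"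
    proof -
      have "1 - real n \<le> of_int k" "of_int k \<le> real n"
        using that by auto
      then show ?thesis
        using x F_def by linarith
    qed
    show "\<bar>x - of_int k\<bar> \<ge> 1 / lam" if "k \<notin> {1 - int n..int n}"
    proof -
      have "k \<le> - int n \<or> k \<ge> int n + 1"
        using that by auto
      then have "of_int k \<le> - real n \<or> of_int k \<ge> real n + 1"
        by auto
      then show ?thesis
        using x F_def by linarith
    qed
  qed simp
  then show ?thesis
    unfolding triangle_exp_sum_about_half[OF x01] C D .
qed

text \<open>
  If instead \<open>0 \<le> x \<le> min f (1 - f)\<close>, the interval \<open>[x - 1/\<lambda>, x + 1/\<lambda>]\<close> runs from
  \<open>x - f - n \<in> [-n - 1, -n]\<close> to \<open>x + f + n \<in> [n, n + 1]\<close>, so the contributing integers are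
  centred at \<open>0\<close>. The slope in \<open>x\<close> then has the real part \<open>-1\<close>: the slopes at \<open>k\<close> and \<open>-k\<close> are
  opposite and multiply conjugate numbers, which leaves only the term \<open>k = 0\<close>.
\<close>

lemma zak_B2_outer:
  fixes lam x \<nu> :: real and n :: nat
  defines "\<theta> \<equiv> pi * \<nu>" and "f \<equiv> 1 / lam - real n"
  assumes lam: "lam > 0" and x: "0 \<le> x" "x \<le> f" "x \<le> 1 - f" and s: "sin \<theta> \<noteq> 0"
  shows "zak lam (\<lambda>t. complex_of_real (B2 t)) x \<nu> = of_real (lam * sqrt lam) *
    Complex (((1 - f) * (sin (real n * \<theta>))\<^sup>2 + f * (sin ((real n + 1) * \<theta>))\<^sup>2) / (sin \<theta>)\<^sup>2 - x)
            (2 * x * (sin (real n * \<theta>) * sin ((real n + 1) * \<theta>) / sin \<theta>))"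
proof -
  have x01: "0 \<le> x" "x \<le> 1"
    using x by linarith+
  have C: "1 / lam + (\<Sum>j<n. 2 * (1 / lam - real j - 1) * cos (2 * (real j + 1) * \<theta>)) =
      ((1 - f) * (sin (real n * \<theta>))\<^sup>2 + f * (sin ((real n + 1) * \<theta>))\<^sup>2) / (sin \<theta>)\<^sup>2"
    unfolding f_def sin_squared_times_interpolated_fejer[symmetric] using s by simp
  have D: "(\<Sum>j<n. sin (2 * (real j + 1) * \<theta>)) =
      sin (real n * \<theta>) * sin ((real n + 1) * \<theta>) / sin \<theta>"
    unfolding sin_times_sum_sin_even[symmetric] using s by simp
  have "zak lam (\<lambda>t. complex_of_real (B2 t)) x \<nu> = of_real (lam * sqrt lam) *
      (\<Sum>k\<in>{- int n..int n}. of_real (1 / lam - \<bar>x - of_int k\<bar>) * cis (2 * of_int k * \<theta>))"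
    unfolding \<theta>_def
  proof (rule zak_B2_eq_sum[OF lam])
    fix k
    show "\<bar>x - of_int k\<bar> \<le> 1 / lam" if "k \<in> {- int n..int n}"
    proof -
      have "- real n \<le> of_int k" "of_int k \<le> real n"
        using that by auto
      then show ?thesis
        using x f_def by linarith
    qed
    show "\<bar>x - of_int k\<bar> \<ge> 1 / lam" if "k \<notin> {- int n..int n}"
    proof -
      have "k \<le> - int n - 1 \<or> k \<ge> int n + 1"
        using that by auto
      then have "of_int k \<le> - real n - 1 \<or> of_int k \<ge> real n + 1"
        by auto
      then show ?thesis
        using x f_def by linarith
    qed
  qed simp
  then show ?thesis
    unfolding triangle_exp_sum_about_zero[OF x01] C D .
qed

text \<open>
  With \<open>p = sin (n\<theta>)\<close> and \<open>q = sin ((n+1)\<theta>)\<close>, a zero requires \<open>xpq = 0\<close>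
  and \<open>(1 - f) p\<^sup>2 + f q\<^sup>2 = x sin\<^sup>2 \<theta>\<close>. By the addition theorem \<open>p = 0\<close> forces
  \<open>q\<^sup>2 = sin\<^sup>2 \<theta>\<close> and vice versa; in particular they cannot both vanish. So \<open>x\<close> would be
  \<open>f\<close> or \<open>1 - f\<close>, or a positive quantity would be \<open>0\<close>.
\<close>

lemma zak_B2_outer_nonzero:
  fixes lam x \<nu> :: real and n :: nat
  defines "\<theta> \<equiv> pi * \<nu>" and "f \<equiv> 1 / lam - real n"
  assumes lam: "lam > 0" and x: "0 \<le> x" "x < f" "x < 1 - f" and s: "sin \<theta> \<noteq> 0"
  shows "zak lam (\<lambda>t. complex_of_real (B2 t)) x \<nu> \<noteq> 0"
proof
  assume zero: "zak lam (\<lambda>t. complex_of_real (B2 t)) x \<nu> = 0"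
  define p q where pq: "p = sin (real n * \<theta>)" "q = sin ((real n + 1) * \<theta>)"
  have "((1 - f) * p\<^sup>2 + f * q\<^sup>2) / (sin \<theta>)\<^sup>2 - x = 0" "2 * x * (p * q / sin \<theta>) = 0"
    using zak_B2_outer[of lam x n \<nu>] zero lam x s
    by (simp_all add: \<theta>_def f_def pq complex_eq_iff)
  then have re: "(1 - f) * p\<^sup>2 + f * q\<^sup>2 = x * (sin \<theta>)\<^sup>2" and im: "x = 0 \<or> p = 0 \<or> q = 0"
    using s by (auto simp: field_simps)
  have q: "q = p * cos \<theta> + cos (real n * \<theta>) * sin \<theta>"
    unfolding pq using sin_add[of "real n * \<theta>" \<theta>] by (simp add: algebra_simps)
  have p: "p = q * cos \<theta> - cos ((real n + 1) * \<theta>) * sin \<theta>"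
    unfolding pq using sin_diff[of "(real n + 1) * \<theta>" \<theta>] by (simp add: algebra_simps)
  have p0: "q\<^sup>2 = (sin \<theta>)\<^sup>2" if "p = 0"
    using q that sin_cos_squared_add[of "real n * \<theta>"] by (simp add: pq power_mult_distrib)
  have q0: "p\<^sup>2 = (sin \<theta>)\<^sup>2" if "q = 0"
    using p that sin_cos_squared_add[of "(real n + 1) * \<theta>"] by (simp add: pq power_mult_distrib)
  consider "p = 0" | "q = 0" | "x = 0" "p \<noteq> 0" "q \<noteq> 0"
    using im by blast
  then show False
  proof cases
    case 1
    then show False
      using re p0 x s by simp
  next
    case 2
    then show False
      using re q0 x s by simp
  next
    case 3
    then have "(1 - f) * p\<^sup>2 > 0" "f * q\<^sup>2 > 0"
      using x by simp_all
    then show False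
      using re 3 by simp
  qed
qed

section \<open>The zeros\<close>

theorem theorem5p2:
  fixes lam \<nu> F :: real and R :: int
  assumes "0 < lam" "lam < 1"
    and "R = round (1 / lam)" "F = signed_frac (1 / lam)"
    and "\<nu> \<in> {0<..<1}"
  shows
    "(\<forall>x \<in> {0..<\<bar>F\<bar>} \<union> {1 - \<bar>F\<bar><..<1}. zak lam (\<lambda>t. complex_of_real (B2 t)) x \<nu> \<noteq> 0) \<and>
     (\<nu> \<in> {of_int s / of_int R | s::int. s \<in> {1..R - 1}} \<longrightarrow>
       (\<forall>x \<in> {\<bar>F\<bar>..1 - \<bar>F\<bar>}. zak lam (\<lambda>t. complex_of_real (B2 t)) x \<nu> = 0)) \<and>
     (\<nu> \<notin> {of_int s / of_int R | s::int. s \<in> {1..R - 1}} \<longrightarrow>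
       (\<forall>x \<in> {\<bar>F\<bar>..1 - \<bar>F\<bar>}. zak lam (\<lambda>t. complex_of_real (B2 t)) x \<nu> = 0 \<longleftrightarrow>
          x = 1/2 \<and> cot (pi * \<nu>) + 2 * F * cot (pi * of_int R * \<nu>) = 0))"
proof -
  let ?Z = "\<lambda>x. zak lam (\<lambda>t. complex_of_real (B2 t)) x \<nu>"
  let ?S = "{of_int s / of_int R | s::int. s \<in> {1..R - 1}} :: real set"
  define \<theta> where "\<theta> = pi * \<nu>"
  define n where "n = nat R"
  have a: "1 / lam > 1"
    using assms by simp
  have R: "R \<ge> 1"
    using a unfolding assms(3) round_def by (simp add: le_floor_iff)
  then have n: "real n = of_int R"
    by (simp add: n_def)
  have F: "F = 1 / lam - real n"
    using assms(3,4) n by (simp add: signed_frac_def)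
  have s: "sin \<theta> > 0"
    unfolding \<theta>_def using assms(5) by (intro sin_gt_zero) auto

  have left: "?Z x \<noteq> 0" if "x \<in> {0..<\<bar>F\<bar>}" for x
  proof -
    define N where "N = nat \<lfloor>1 / lam\<rfloor>"
    have "\<lfloor>1 / lam\<rfloor> \<ge> 0"
      using a by linarith
    then have N: "real N = of_int \<lfloor>1 / lam\<rfloor>"
      unfolding N_def by (rule of_nat_nat)
    \<comment> \<open>The nearest integer is at least as close to \<open>1/\<lambda>\<close> as its two neighbours \<open>N\<close> and \<open>N + 1\<close>.\<close>
    have "\<bar>F\<bar> \<le> \<bar>1 / lam - of_int \<lfloor>1 / lam\<rfloor>\<bar>" "\<bar>F\<bar> \<le> \<bar>1 / lam - of_int (\<lfloor>1 / lam\<rfloor> + 1)\<bar>"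
      unfolding assms(4) signed_frac_def by (rule round_diff_minimal)+
    then have "\<bar>F\<bar> \<le> 1 / lam - real N" "\<bar>F\<bar> \<le> 1 - (1 / lam - real N)"
      unfolding N of_int_add of_int_1 by linarith+
    then show ?thesis
      using that s assms(1) unfolding \<theta>_def by (intro zak_B2_outer_nonzero[of lam x N]) auto
  qed
  have right: "?Z x \<noteq> 0" if "x \<in> {1 - \<bar>F\<bar><..<1}" for x
    using left[of "1 - x"] that zak_B2_reflect_eq_0_iff[of lam x \<nu>] by auto

  have S_iff: "\<nu> \<in> ?S \<longleftrightarrow> sin (real n * \<theta>) = 0"
  proof -
    have "sin (real n * \<theta>) = 0 \<longleftrightarrow> of_int R * \<nu> \<in> \<int>"
      using sin_times_pi_eq_0[of "of_int R * \<nu>"] by (simp add: \<theta>_def n mult_ac)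
    also have "\<dots> \<longleftrightarrow> \<nu> \<in> ?S"
    proof
      assume "of_int R * \<nu> \<in> \<int>"
      then obtain k where k: "of_int R * \<nu> = of_int k"
        by (auto elim: Ints_cases)
      have "0 < of_int R * \<nu>" "of_int R * \<nu> < of_int R"
        using R assms(5) by auto
      then have "k \<in> {1..R - 1}"
        unfolding k by auto
      moreover have "\<nu> = of_int k / of_int R"
        using k R by (simp add: field_simps)
      ultimately show "\<nu> \<in> ?S"
        by blast
    qed (use R in auto)
    finally show ?thesis
      by blast
  qed

  have central: "?Z x = 0 \<longleftrightarrow>
      (cos \<theta> * (sin (real n * \<theta>))\<^sup>2 + 2 * F * (sin \<theta> * sin (real n * \<theta>) * cos (real n * \<theta>)) = 0 \<and>
       (x = 1/2 \<or> sin (real n * \<theta>) = 0))" if "x \<in> {\<bar>F\<bar>..1 - \<bar>F\<bar>}" for x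
  proof -
    have "2 * x - 1 = 0 \<longleftrightarrow> x = 1/2"
      by auto
    then show ?thesis
      using zak_B2_central[of lam n x \<nu>] that s assms(1)
      by (simp add: \<theta>_def[symmetric] F[symmetric] complex_eq_iff[of "Complex _ _"] cis_neq_zero)
  qed

  have cot_form: "cos \<theta> * (sin (real n * \<theta>))\<^sup>2 +
      2 * F * (sin \<theta> * sin (real n * \<theta>) * cos (real n * \<theta>)) =
      sin \<theta> * (sin (real n * \<theta>))\<^sup>2 * (cot (pi * \<nu>) + 2 * F * cot (pi * of_int R * \<nu>))"
    if "sin (real n * \<theta>) \<noteq> 0"
  proof -
    have "pi * of_int R * \<nu> = real n * \<theta>"
      by (simp add: \<theta>_def n)
    then show ?thesis
      using that s unfolding \<theta>_def[symmetric]
      by (simp add: cot_def field_simps power2_eq_square)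
  qed

  show ?thesis
  proof (intro conjI impI ballI)
    fix x assume "x \<in> {0..<\<bar>F\<bar>} \<union> {1 - \<bar>F\<bar><..<1}"
    then show "?Z x \<noteq> 0"
      using left right by blast
  next
    fix x assume "\<nu> \<in> ?S" "x \<in> {\<bar>F\<bar>..1 - \<bar>F\<bar>}"
    then show "?Z x = 0"
      unfolding S_iff by (simp add: central)
  next
    fix x assume "\<nu> \<notin> ?S" and x: "x \<in> {\<bar>F\<bar>..1 - \<bar>F\<bar>}"
    then have q: "sin (real n * \<theta>) \<noteq> 0"
      unfolding S_iff by simp
    show "?Z x = 0 \<longleftrightarrow> x = 1/2 \<and> cot (pi * \<nu>) + 2 * F * cot (pi * of_int R * \<nu>) = 0"
      unfolding central[OF x] cot_form[OF q] using q s by auto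
  qed
qed

end
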